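(* Let $X^{(i)}=(X^{(i)}_n)_{n\ge 1}$, $i=1,2$, be two global Leray-Hopf solutions of the dyadic system $$\frac{d}{dt}X_n(t)=k_{n-1}X_{n-1}^2(t)-k_nX_n(t)X_{n+1}(t),\qquad t\ge 0,\ n\ge 1,$$ with the same initial condition $x=(x_n)_{n\ge1}\in H=\ell^2$. Assume that $X^{(1)}$ and $X^{(2)}$ are both of class $\mathcal K$. Then $X^{(1)}=X^{(2)}$. In particular, the assumption that $X^{(1)}$ and $X^{(2)}$ are of class $\mathcal K$ is satisfied if $x$ has at most a finite number of negative components.
   Context: Standing assumptions: $(k_n)_{n\ge0}$ is a fixed real sequence with $k_0=0$ and $0\le k_n\le C2^n$ for all $n\ge1$, for some constant $C$; by convention $X_0(t)=0$ for all $t\ge0$. $H=\ell^2$ is the space of real square-summable sequences indexed by $n\ge1$, with its usual norm $\|\cdot\|_H$. A solution on $[0,T)$ (global solution if $T=+\infty$) with initial condition $x$ is a function $X=(X_n)_{n\ge1}$ defined on $[0,T)$ such that $X_n\in C^1([0,T))$ for all $n\ge1$, the system of equations holds for all $n\ge 1$ with $X_n(0)=x_n$, and $X(t)\in H$ for all $t\in[0,T)$. A Leray-Hopf solution is a solution satisfying the strong energy inequality: $\|X(s)\|_H\ge\|X(t)\|_H$ for all $s,t\in[0,T)$ with $s<t$. A (global) solution $X$ is of class $\mathcal K$ if the function $a(t)=\sup_{n\ge 1}\bigl(-k_nX_{n+1}(t)\bigr)$ is locally integrable on $[0,\infty)$. *)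

theory Defs
  imports "HOL-Analysis.Analysis"
begin

text \<open>
  Sequences indexed by \<open>n \<ge> 1\<close> are functions on \<^typ>\<open>nat\<close>. The value at \<open>0\<close> is ignored, except
  that a solution satisfies the convention \<open>X\<^sub>0 = 0\<close>.
\<close>

definition dyadic_coeffs :: "(nat \<Rightarrow> real) \<Rightarrow> bool" where
  "dyadic_coeffs k \<longleftrightarrow> k 0 = 0 \<and> (\<exists>C. \<forall>n\<ge>1. 0 \<le> k n \<and> k n \<le> C * 2 ^ n)"

definition in_H :: "(nat \<Rightarrow> real) \<Rightarrow> bool" where
  "in_H x \<longleftrightarrow> (\<lambda>n. (x n)\<^sup>2) summable_on {1..}"

definition norm_H :: "(nat \<Rightarrow> real) \<Rightarrow> real" where
  "norm_H x = sqrt (\<Sum>\<^sub>\<infinity>n\<in>{1..}. (x n)\<^sup>2)"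

definition time_dom :: "ereal \<Rightarrow> real set" where
  "time_dom T = {t. 0 \<le> t \<and> ereal t < T}"

text \<open>
  Derivatives are taken within the set, hence one-sided at the endpoint \<open>0\<close> of \<^term>\<open>time_dom T\<close>
  (the library's \<^const>\<open>C1_differentiable_on\<close> asks for a two-sided derivative there).
\<close>

definition C1_within :: "real set \<Rightarrow> (real \<Rightarrow> real) \<Rightarrow> bool" where
  "C1_within S f \<longleftrightarrow>
     (\<exists>f'. (\<forall>t\<in>S. (f has_real_derivative f' t) (at t within S)) \<and> continuous_on S f')"

definition dyadic_solution ::
    "(nat \<Rightarrow> real) \<Rightarrow> ereal \<Rightarrow> (nat \<Rightarrow> real) \<Rightarrow> (nat \<Rightarrow> real \<Rightarrow> real) \<Rightarrow> bool" where
  "dyadic_solution k T x X \<longleftrightarrow>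
     (\<forall>t\<in>time_dom T. X 0 t = 0) \<and>
     (\<forall>n\<ge>1. C1_within (time_dom T) (X n)) \<and>
     (\<forall>n\<ge>1. X n 0 = x n) \<and>
     (\<forall>n\<ge>1. \<forall>t\<in>time_dom T.
        (X n has_real_derivative
           k (n - 1) * (X (n - 1) t)\<^sup>2 - k n * X n t * X (n + 1) t) (at t within time_dom T)) \<and>
     (\<forall>t\<in>time_dom T. in_H (\<lambda>n. X n t))"

definition leray_hopf_solution ::
    "(nat \<Rightarrow> real) \<Rightarrow> ereal \<Rightarrow> (nat \<Rightarrow> real) \<Rightarrow> (nat \<Rightarrow> real \<Rightarrow> real) \<Rightarrow> bool" where
  "leray_hopf_solution k T x X \<longleftrightarrow>
     dyadic_solution k T x X \<and>
     (\<forall>s\<in>time_dom T. \<forall>t\<in>time_dom T. s < t \<longrightarrow> norm_H (\<lambda>n. X n s) \<ge> norm_H (\<lambda>n. X n t))"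

definition locally_integrable_on :: "(real \<Rightarrow> ereal) \<Rightarrow> real set \<Rightarrow> bool" where
  "locally_integrable_on f S \<longleftrightarrow>
     (\<forall>K. compact K \<and> K \<subseteq> S \<longrightarrow>
        f \<in> borel_measurable (lebesgue_on K) \<and>
        (\<integral>\<^sup>+ t. e2ennreal \<bar>f t\<bar> \<partial>lebesgue_on K) < \<infinity>)"

text \<open>
  The supremum is extended-real valued: \<open>k\<^sub>n\<close> may grow like \<open>2\<^sup>n\<close>, so it can be infinite for
  \<open>X(t) \<in> H\<close>.
\<close>

definition class_K :: "(nat \<Rightarrow> real) \<Rightarrow> (nat \<Rightarrow> real \<Rightarrow> real) \<Rightarrow> bool" where
  "class_K k X \<longleftrightarrow>
     locally_integrable_on (\<lambda>t. SUP n\<in>{1..}. ereal (- k n * X (n + 1) t)) {0..}"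

end

theory Submission
  imports Defs
begin

text \<open>
  For two solutions \<open>X\<close>, \<open>Y\<close> put \<open>W\<^sub>N = \<Sum>\<^sub>n\<^sub>\<le>\<^sub>N 2\<^sup>-\<^sup>n (X\<^sub>n - Y\<^sub>n)\<^sup>2\<close>. Its derivative is at most
  \<open>b W\<^sub>N + R\<^sub>N\<close>, where \<open>b\<close> is the sum of the two integrable class \<open>\<K>\<close> bounds and
  \<open>R\<^sub>N = O(X\<^sub>N\<^sup>2 + Y\<^sub>N\<^sup>2)\<close>, because \<open>k\<^sub>N = O(2\<^sup>N)\<close>. The energy bound makes the integrals of
  \<open>X\<^sub>N\<^sup>2 + Y\<^sub>N\<^sup>2\<close> summable, so the remainder disappears as \<open>N \<rightarrow> \<infinity>\<close>. On an interval where
  \<open>b\<close> has integral at most \<open>1/2\<close>, this turns any bound \<open>S\<close> for all \<open>W\<^sub>N\<close> into \<open>S/2\<close>, hence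
  \<open>X = Y\<close> there, and finitely many such intervals cover \<open>[0,t]\<close>. Nonnegative components stay
  nonnegative, so with finitely many negative \<open>x\<^sub>n\<close> only finitely many continuous terms of the
  supremum can be positive.
\<close>

section \<open>Continuity and energy bounds of solutions\<close>

lemma time_dom_infinity: "time_dom \<infinity> = {0..}"
  by (auto simp: time_dom_def)

lemma dyadic_solution_continuous_on:
  assumes "dyadic_solution k \<infinity> x X"
  shows "continuous_on {0..} (X n)"
proof (cases "n = 0")
  case True
  then show ?thesis
    using assms
    by (intro continuous_on_eq[OF continuous_on_const[of _ 0]])
       (auto simp: dyadic_solution_def time_dom_infinity)
next
  case False
  then have "(X n has_real_derivative
      k (n - 1) * (X (n - 1) t)\<^sup>2 - k n * X n t * X (n + 1) t) (at t within {0..})" if "t \<in> {0..}" for t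
    using assms that by (auto simp: dyadic_solution_def time_dom_infinity)
  then show ?thesis by (rule DERIV_continuous_on)
qed

text \<open>Partial sums are at most the full energy, which never exceeds its initial value. The
  convention \<open>X 0 t = 0\<close> lets the sum start at index 0.\<close>

lemma leray_hopf_energy_bound:
  assumes "leray_hopf_solution k \<infinity> x X" and "t \<ge> 0"
  shows "(\<Sum>n<N. (X n t)\<^sup>2) \<le> (norm_H x)\<^sup>2"
proof -
  have sol: "dyadic_solution k \<infinity> x X"
    and decay: "\<And>t. t > 0 \<Longrightarrow> norm_H (\<lambda>n. X n t) \<le> norm_H (\<lambda>n. X n 0)"
    using assms(1) by (auto simp: leray_hopf_solution_def time_dom_infinity)
  have "(\<lambda>n. (X n t)\<^sup>2) summable_on {1..}" and X0: "X 0 t = 0"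
    using sol assms(2) by (auto simp: dyadic_solution_def time_dom_infinity in_H_def)
  then have "(\<Sum>n\<in>{1..<N}. (X n t)\<^sup>2) \<le> (\<Sum>\<^sub>\<infinity>n\<in>{1..}. (X n t)\<^sup>2)"
    by (intro finite_sum_le_infsum) auto
  also have "\<dots> = (norm_H (\<lambda>n. X n t))\<^sup>2"
    by (simp add: norm_H_def infsum_nonneg)
  also have "\<dots> \<le> (norm_H (\<lambda>n. X n 0))\<^sup>2"
    \<comment> \<open>The energy inequality compares strictly ordered times, so \<open>t = 0\<close>
      is a separate case.\<close>
    using decay[of t] assms(2)
    by (cases "t = 0") (auto intro!: power_mono simp: norm_H_def infsum_nonneg)
  also have "norm_H (\<lambda>n. X n 0) = norm_H x"
    using sol unfolding norm_H_def dyadic_solution_def by (auto intro!: infsum_cong)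
  finally have "(\<Sum>n\<in>{1..<N}. (X n t)\<^sup>2) \<le> (norm_H x)\<^sup>2" .
  moreover have "(\<Sum>n\<in>{1..<N}. (X n t)\<^sup>2) = (\<Sum>n<N. (X n t)\<^sup>2)"
    using X0 by (intro sum.mono_neutral_left) (auto simp: not_less_eq_eq Suc_le_eq)
  ultimately show ?thesis by simp
qed

section \<open>Derivative of the weighted difference\<close>

text \<open>
  The weights \<open>2\<^sup>-\<^sup>n\<close> are the ones for which the terms
  \<open>k\<^sub>n (X\<^sub>n + Y\<^sub>n) (X\<^sub>n - Y\<^sub>n) (X\<^sub>n\<^sub>+\<^sub>1 - Y\<^sub>n\<^sub>+\<^sub>1)\<close> telescope.
\<close>

lemma weighted_difference_has_derivative:
  fixes X Y :: "nat \<Rightarrow> real \<Rightarrow> real"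
  assumes k0: "k 0 = 0"
    and X: "\<And>n. n \<ge> 1 \<Longrightarrow> (X n has_real_derivative
      k (n - 1) * (X (n - 1) t)\<^sup>2 - k n * X n t * X (n + 1) t) (at t within S)"
    and Y: "\<And>n. n \<ge> 1 \<Longrightarrow> (Y n has_real_derivative
      k (n - 1) * (Y (n - 1) t)\<^sup>2 - k n * Y n t * Y (n + 1) t) (at t within S)"
  shows "((\<lambda>t. \<Sum>n=1..N. (X n t - Y n t)\<^sup>2 / 2 ^ n) has_real_derivative
      - (\<Sum>n=1..N. k n * (X (n + 1) t + Y (n + 1) t) * ((X n t - Y n t)\<^sup>2 / 2 ^ n))
      - k N / 2 ^ N * ((X N t)\<^sup>2 - (Y N t)\<^sup>2) * (X (N + 1) t - Y (N + 1) t)) (at t within S)"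
proof (induction N)
  case 0
  then show ?case using k0 by simp
next
  case (Suc N)
  have "((\<lambda>t. (X (Suc N) t - Y (Suc N) t)\<^sup>2 / 2 ^ Suc N) has_real_derivative
      2 * (X (Suc N) t - Y (Suc N) t) *
        ((k N * (X N t)\<^sup>2 - k (Suc N) * X (Suc N) t * X (Suc N + 1) t)
         - (k N * (Y N t)\<^sup>2 - k (Suc N) * Y (Suc N) t * Y (Suc N + 1) t)) / 2 ^ Suc N)
      (at t within S)"
    using X[of "Suc N"] Y[of "Suc N"] by (auto intro!: derivative_eq_intros simp: field_simps)
  \<comment> \<open>The factor 2 from the square turns \<open>2 ^ Suc N\<close> into
    \<open>2 ^ N\<close>, so the new \<open>k N\<close> term cancels the old boundary term. The
    identity \<open>2 * (a * a' - b * b') = (a - b) * (a' + b') + (a + b) * (a' - b')\<close> splits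
    the \<open>k (Suc N)\<close> term into the new summand and the new boundary term.\<close>
  from DERIV_add[OF Suc this] show ?case
    by (auto elim!: DERIV_cong simp: field_simps power2_eq_square)
qed

section \<open>Integral estimates\<close>

text \<open>The integrals are nonnegative and their partial sums are at most the integral of
  \<open>B\<close>, so they form a convergent series. This removes the truncation remainder.\<close>

lemma integral_terms_tendsto_0:
  fixes f :: "nat \<Rightarrow> real \<Rightarrow> real"
  assumes cont: "\<And>n. continuous_on {a..b} (f n)"
    and nonneg: "\<And>n t. t \<in> {a..b} \<Longrightarrow> f n t \<ge> 0"
    and bound: "\<And>N t. t \<in> {a..b} \<Longrightarrow> (\<Sum>n<N. f n t) \<le> B"
  shows "(\<lambda>n. integral {a..b} (f n)) \<longlonglongrightarrow> 0"
proof (rule summable_LIMSEQ_zero, rule summableI_nonneg_bounded)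
  show "0 \<le> integral {a..b} (f n)" for n
    using nonneg by (intro integral_nonneg integrable_continuous_real cont) auto
  show "(\<Sum>n<N. integral {a..b} (f n)) \<le> integral {a..b} (\<lambda>_. B)" for N
    by (subst Henstock_Kurzweil_Integration.integral_sum[symmetric], simp,
        intro integrable_continuous_real cont,
        intro integral_le integrable_continuous_real continuous_on_sum cont bound)
       auto
qed

text \<open>An indefinite integral is uniformly continuous on a compact interval. The resulting
  \<open>d\<close> is a step length independent of the starting point.\<close>

lemma integral_small_on_short_intervals:
  fixes b :: "real \<Rightarrow> real"
  assumes b: "b integrable_on {a..c}" and "e > 0"
  shows "\<exists>d>0. \<forall>r s. a \<le> r \<longrightarrow> r \<le> s \<longrightarrow> s \<le> c \<longrightarrow> s - r < d \<longrightarrow> integral {r..s} b < e"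
proof -
  have "uniformly_continuous_on {a..c} (\<lambda>t. integral {a..t} b)"
    by (intro compact_uniformly_continuous indefinite_integral_continuous_1 b) auto
  then obtain d where "d > 0"
    and d: "\<And>r s. r \<in> {a..c} \<Longrightarrow> s \<in> {a..c} \<Longrightarrow> dist s r < d \<Longrightarrow>
      dist (integral {a..s} b) (integral {a..r} b) < e"
    using \<open>e > 0\<close> unfolding uniformly_continuous_on_def by blast
  have "integral {r..s} b < e" if "a \<le> r" "r \<le> s" "s \<le> c" "s - r < d" for r s
  proof -
    have "b integrable_on {a..s}"
      by (rule integrable_on_subinterval[OF b]) (use that in auto)
    then have "integral {a..r} b + integral {r..s} b = integral {a..s} b"
      using that by (intro Henstock_Kurzweil_Integration.integral_combine) auto
    then show ?thesis using d[of r s] that by (auto simp: dist_real_def)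
  qed
  with \<open>d > 0\<close> show ?thesis by blast
qed

text \<open>Replacing \<open>f\<close> by \<open>g\<close> on \<open>M\<close> leaves the integral
  unchanged and makes the comparison hold pointwise.\<close>

lemma integral_le_except_negligible:
  fixes f g :: "real \<Rightarrow> real"
  assumes "f integrable_on S" "g integrable_on S" "negligible M"
    and "\<And>t. t \<in> S - M \<Longrightarrow> f t \<le> g t"
  shows "integral S f \<le> integral S g"
proof -
  let ?f = "\<lambda>t. if t \<in> M then g t else f t"
  have "?f integrable_on S"
    by (rule integrable_spike[OF assms(1,3)]) auto
  then have "integral S ?f \<le> integral S g"
    using assms by (intro integral_le) auto
  moreover have "integral S ?f = integral S f"
    by (rule integral_spike[OF assms(3)]) auto
  ultimately show ?thesis by simp
qed

text \<open>The supremum in the class K condition has a finite integral in absolute value, so it is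
  infinite only on a negligible set, taken as \<open>M\<close>. As \<open>enn2real\<close> sends
  infinity to 0, the real function \<open>b\<close> dominates the terms off \<open>M\<close> only;
  the absolute value makes it nonnegative.\<close>

lemma class_K_integrable_bound:
  assumes "class_K k X"
  obtains b M where "b integrable_on {0..T}" "negligible M" "\<And>t. b t \<ge> 0"
    "\<And>n t. n \<ge> 1 \<Longrightarrow> t \<in> {0..T} - M \<Longrightarrow> - k n * X (n + 1) t \<le> b t"
proof -
  define f where "f t = (SUP n\<in>{1..}. ereal (- k n * X (n + 1) t))" for t
  define g where "g t = e2ennreal \<bar>f t\<bar>" for t
  let ?L = "lebesgue_on {0..T}"
  have f: "f \<in> borel_measurable ?L" and fin: "(\<integral>\<^sup>+ t. g t \<partial>?L) < \<infinity>"
    using assms unfolding class_K_def locally_integrable_on_def f_def g_def by auto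
  have g: "g \<in> borel_measurable ?L"
    unfolding g_def using f by measurable
  have "AE t in ?L. g t \<noteq> \<infinity>"
    using nn_integral_PInf_AE[OF g] fin by auto
  then have "AE t in lebesgue. t \<in> {0..T} \<longrightarrow> g t \<noteq> \<infinity>"
    by (subst (asm) AE_restrict_space_iff) auto
  then obtain M where "negligible M" "{t. \<not> (t \<in> {0..T} \<longrightarrow> g t \<noteq> \<infinity>)} \<subseteq> M"
    unfolding eventually_ae_filter_negligible by blast
  then have "negligible {t\<in>{0..T}. g t = \<infinity>}"
    by (auto intro: negligible_subset)
  moreover have "(\<lambda>t. enn2real (g t)) integrable_on {0..T}"
  proof (rule integrable_on_lebesgue_on)
    have "(\<integral>\<^sup>+ t. ennreal (enn2real (g t)) \<partial>?L) \<le> (\<integral>\<^sup>+ t. g t \<partial>?L)"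
      by (intro nn_integral_mono) (simp add: ennreal_enn2real_if)
    with fin show "integrable ?L (\<lambda>t. enn2real (g t))"
      using g by (intro integrableI_nonneg) auto
  qed auto
  moreover have "- k n * X (n + 1) t \<le> enn2real (g t)"
    if "n \<ge> 1" "t \<in> {0..T} - {t\<in>{0..T}. g t = \<infinity>}" for n t
  proof -
    have "ereal (- k n * X (n + 1) t) \<le> f t"
      unfolding f_def using that(1) by (intro SUP_upper) auto
    also have "\<dots> \<le> \<bar>f t\<bar>" by (cases "f t") auto
    finally have *: "ereal (- k n * X (n + 1) t) \<le> \<bar>f t\<bar>" .
    show ?thesis using that(2) * unfolding g_def
      by (cases "f t") (auto simp: e2ennreal_infty)
  qed
  ultimately show ?thesis by (intro that[of "\<lambda>t. enn2real (g t)"]) auto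
qed


section \<open>Uniqueness on a short interval\<close>

text \<open>Integrating the differential inequality from \<open>r\<close>, where the difference
  vanishes, replaces a bound \<open>S\<close> by \<open>S / 2\<close> plus a remainder.
  \<open>S\<close> has to bound every \<open>W N\<close> on the whole interval, so that the
  remainder can vanish in the limit and the step can be repeated.\<close>

lemma local_uniqueness:
  fixes X Y :: "nat \<Rightarrow> real \<Rightarrow> real"
  assumes k0: "k 0 = 0" and k: "\<And>n. n \<ge> 1 \<Longrightarrow> 0 \<le> k n \<and> k n \<le> C * 2 ^ n"
    and X: "\<And>n t. n \<ge> 1 \<Longrightarrow> t \<in> {r..s} \<Longrightarrow> (X n has_real_derivative
      k (n - 1) * (X (n - 1) t)\<^sup>2 - k n * X n t * X (n + 1) t) (at t within {r..s})"
    and Y: "\<And>n t. n \<ge> 1 \<Longrightarrow> t \<in> {r..s} \<Longrightarrow> (Y n has_real_derivative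
      k (n - 1) * (Y (n - 1) t)\<^sup>2 - k n * Y n t * Y (n + 1) t) (at t within {r..s})"
    and cont: "\<And>n. continuous_on {r..s} (X n)" "\<And>n. continuous_on {r..s} (Y n)"
    and energy: "\<And>N t. t \<in> {r..s} \<Longrightarrow> (\<Sum>n<N. (X n t)\<^sup>2) \<le> B"
      "\<And>N t. t \<in> {r..s} \<Longrightarrow> (\<Sum>n<N. (Y n t)\<^sup>2) \<le> B"
    and init: "\<And>n. n \<ge> 1 \<Longrightarrow> X n r = Y n r"
    and b: "b integrable_on {r..s}" "\<And>t. b t \<ge> 0" "integral {r..s} b \<le> 1 / 2"
    and M: "negligible M" "\<And>n t. n \<ge> 1 \<Longrightarrow> t \<in> {r..s} - M \<Longrightarrow>
      - k n * (X (n + 1) t + Y (n + 1) t) \<le> b t"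
    and nt: "n \<ge> 1" "t \<in> {r..s}"
  shows "X n t = Y n t"
proof -
  define W where "W N t = (\<Sum>n=1..N. (X n t - Y n t)\<^sup>2 / 2 ^ n)" for N t
  define R where "R N t = - (k N / 2 ^ N * ((X N t)\<^sup>2 - (Y N t)\<^sup>2) * (X (N + 1) t - Y (N + 1) t))" for N t
  define W' where "W' N t = - (\<Sum>n=1..N. k n * (X (n + 1) t + Y (n + 1) t) *
    ((X n t - Y n t)\<^sup>2 / 2 ^ n)) + R N t" for N t
  define Q where "Q N t = (X N t)\<^sup>2 + (Y N t)\<^sup>2" for N t
  \<comment> \<open>\<open>C\<close> bounds \<open>k N / 2 ^ N\<close>, and
    \<open>sqrt (4 * B)\<close> bounds the difference of the components at \<open>N + 1\<close>,
    whose square is at most \<open>2 * Q (N + 1) t\<close> with \<open>Q (N + 1) t\<close> at most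
    \<open>2 * B\<close>.\<close>
  define D where "D = C * sqrt (4 * B)"
  have "C \<ge> 0" using k[of 1] by simp
  have "B \<ge> 0" using energy(1)[of t 0] nt(2) by simp
  have W_nonneg: "W N t \<ge> 0" for N t
    unfolding W_def by (intro sum_nonneg) auto
  have W_mono: "W N t \<le> W N' t" if "N \<le> N'" for N N' t
    unfolding W_def using that by (intro sum_mono2) auto
  have Q_nonneg: "Q N t \<ge> 0" for N t by (simp add: Q_def)
  have Q_sum: "(\<Sum>n<N. Q n t) \<le> 2 * B" if "t \<in> {r..s}" for N t
    using energy[OF that, of N] by (simp add: Q_def sum.distrib)
  have sq_diff: "(X n t - Y n t)\<^sup>2 \<le> 2 * Q n t" for n t
    using zero_le_power2[of "X n t + Y n t"] unfolding Q_def
    by (simp add: power2_eq_square algebra_simps)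
  have Q_cont: "continuous_on {r..s} (Q N)" for N
    unfolding Q_def by (intro continuous_intros cont)
  have D_nonneg: "D \<ge> 0" using \<open>C \<ge> 0\<close> \<open>B \<ge> 0\<close> by (simp add: D_def)
  have R_le: "R N t \<le> D * Q N t" if "t \<in> {r..s}" for N t
  proof -
    have 1: "\<bar>k N / 2 ^ N\<bar> \<le> C"
      using k[of N] k0 \<open>C \<ge> 0\<close> by (cases "N = 0") (auto simp: field_simps)
    have 2: "\<bar>(X N t)\<^sup>2 - (Y N t)\<^sup>2\<bar> \<le> Q N t"
      by (auto simp: Q_def abs_le_iff)
    have "Q (N + 1) t \<le> (\<Sum>n<N + 2. Q n t)"
      by (intro member_le_sum Q_nonneg) auto
    with Q_sum[OF that, of "N + 2"] sq_diff[of "N + 1" t]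
    have "(X (N + 1) t - Y (N + 1) t)\<^sup>2 \<le> 4 * B" by linarith
    then have 3: "\<bar>X (N + 1) t - Y (N + 1) t\<bar> \<le> sqrt (4 * B)"
      using real_sqrt_le_mono by fastforce
    have "R N t \<le> \<bar>k N / 2 ^ N\<bar> * \<bar>(X N t)\<^sup>2 - (Y N t)\<^sup>2\<bar> * \<bar>X (N + 1) t - Y (N + 1) t\<bar>"
      unfolding R_def abs_mult[symmetric] by linarith
    also have "\<dots> \<le> C * Q N t * sqrt (4 * B)"
      by (intro mult_mono 1 2 3) (use \<open>C \<ge> 0\<close> Q_nonneg in auto)
    finally show ?thesis by (simp add: D_def mult_ac)
  qed
  have W_deriv: "(W N has_real_derivative W' N t) (at t within {r..s})" if "t \<in> {r..s}" for N t
    using weighted_difference_has_derivative[of k X t "{r..s}" Y N, OF k0 X Y] that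
    unfolding W_def W'_def R_def by simp
  have W_init: "W N r = 0" for N
    unfolding W_def using init by simp
  have halve: "W N t \<le> S / 2" if S: "\<And>N t. t \<in> {r..s} \<Longrightarrow> W N t \<le> S" and t: "t \<in> {r..s}" for S N t
  proof -
    have bound: "W N t \<le> S / 2 + D * integral {r..s} (Q N)" for N
    proof -
      have sub: "{r..t} \<subseteq> {r..s}" using t by auto
      have S0: "S \<ge> 0" using S[OF t, of N] W_nonneg[of N t] by linarith
      have int_b: "b integrable_on {r..t}"
        by (rule integrable_on_subinterval[OF b(1) sub])
      have int_Q: "Q N integrable_on {r..s}" "Q N integrable_on {r..t}"
        by (intro integrable_continuous_real continuous_on_subset[OF Q_cont] order_refl sub)+
      have "(W' N has_integral (W N t - W N r)) {r..t}"
        using t sub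
        by (intro fundamental_theorem_of_calculus)
           (auto simp: has_real_derivative_iff_has_vector_derivative[symmetric]
             intro!: DERIV_subset[OF W_deriv sub])
      then have int_W': "W' N integrable_on {r..t}" "integral {r..t} (W' N) = W N t"
        using W_init by (auto simp: has_integral_iff)
      have "W N t = integral {r..t} (W' N)" by (simp add: int_W')
      also have "\<dots> \<le> integral {r..t} (\<lambda>u. S * b u + D * Q N u)"
      proof (rule integral_le_except_negligible[OF int_W'(1) _ M(1)])
        show "(\<lambda>u. S * b u + D * Q N u) integrable_on {r..t}"
          by (intro integrable_add integrable_on_mult_right int_b int_Q)
        fix u assume "u \<in> {r..t} - M"
        then have u: "u \<in> {r..s} - M" using sub by auto
        \<comment> \<open>The one-sided bound \<open>b\<close> suffices here because each
          coefficient multiplies a nonnegative weighted square.\<close>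
        have "(\<Sum>n=1..N. - k n * (X (n + 1) u + Y (n + 1) u) * ((X n u - Y n u)\<^sup>2 / 2 ^ n))
            \<le> (\<Sum>n=1..N. b u * ((X n u - Y n u)\<^sup>2 / 2 ^ n))"
          using M(2)[OF _ u] by (intro sum_mono mult_right_mono) auto
        also have "\<dots> = b u * W N u" by (simp add: W_def sum_distrib_left)
        also have "\<dots> \<le> b u * S" using S[of u N] u b(2) by (intro mult_left_mono) auto
        finally show "W' N u \<le> S * b u + D * Q N u"
          using R_le[of u N] u by (simp add: W'_def sum_negf mult_ac)
      qed
      also have "\<dots> = S * integral {r..t} b + D * integral {r..t} (Q N)"
        by (subst Henstock_Kurzweil_Integration.integral_add)
           (auto intro: integrable_on_mult_right int_b int_Q)
      \<comment> \<open>Both integrands are nonnegative, so the integrals may be extended from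
        \<open>{r..t}\<close> to \<open>{r..s}\<close>, where the bound \<open>1 / 2\<close> is
        known.\<close>
      also have "\<dots> \<le> S * integral {r..s} b + D * integral {r..s} (Q N)"
        by (intro add_mono mult_left_mono integral_subset_le sub int_b b int_Q Q_nonneg S0 D_nonneg ballI)
      also have "\<dots> \<le> S * (1 / 2) + D * integral {r..s} (Q N)"
        by (intro add_right_mono mult_left_mono b S0)
      finally show ?thesis by simp
    qed
    have "(\<lambda>N. integral {r..s} (Q N)) \<longlonglongrightarrow> 0"
      using Q_cont Q_nonneg Q_sum by (rule integral_terms_tendsto_0)
    then have "(\<lambda>N. S / 2 + D * integral {r..s} (Q N)) \<longlonglongrightarrow> S / 2 + D * 0"
      by (intro tendsto_intros)
    \<comment> \<open>The index \<open>N\<close> stays fixed while the remainder is taken at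
      \<open>N'\<close>. Since \<open>W\<close> increases with its index, \<open>W N t\<close> lies
      below the bound for every larger \<open>N'\<close>.\<close>
    then have "W N t \<le> S / 2 + D * 0"
    proof (rule tendsto_lowerbound)
      show "\<forall>\<^sub>F N' in sequentially. W N t \<le> S / 2 + D * integral {r..s} (Q N')"
        using eventually_ge_at_top[of N]
      proof eventually_elim
        case (elim N')
        with W_mono[of N N' t] bound[of N'] show ?case by linarith
      qed
    qed simp
    then show ?thesis by simp
  qed
  \<comment> \<open>This starts the iteration: drop the weights, then use \<open>sq_diff\<close> and
    the energy bound.\<close>
  have W_bound: "W N t \<le> 4 * B" if "t \<in> {r..s}" for N t
  proof -
    have "W N t \<le> (\<Sum>n=1..N. 2 * Q n t)"
      unfolding W_def
    proof (intro sum_mono)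
      fix n
      have "(X n t - Y n t)\<^sup>2 / 2 ^ n \<le> (X n t - Y n t)\<^sup>2"
        by (simp add: divide_le_eq mult_le_cancel_left1)
      with sq_diff[of n t] show "(X n t - Y n t)\<^sup>2 / 2 ^ n \<le> 2 * Q n t" by linarith
    qed
    also have "\<dots> \<le> (\<Sum>n<Suc N. 2 * Q n t)"
      by (intro sum_mono2) (auto simp: Q_nonneg)
    also have "\<dots> \<le> 4 * B"
      using Q_sum[OF that, of "Suc N"] by (simp add: sum_distrib_left[symmetric] del: sum.lessThan_Suc)
    finally show ?thesis .
  qed
  have W_iterate: "W N t \<le> 4 * B * (1 / 2) ^ m" if "t \<in> {r..s}" for N m t
    using that
  proof (induction m arbitrary: N t)
    case (Suc m)
    from halve[OF Suc.IH Suc.prems] show ?case by simp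
  qed (simp add: W_bound)
  have "(\<lambda>m. 4 * B * (1 / 2) ^ m) \<longlonglongrightarrow> 4 * B * 0"
    by (intro tendsto_intros LIMSEQ_power_zero) auto
  then have "W n t \<le> 4 * B * 0"
    by (rule tendsto_lowerbound) (auto intro!: always_eventually W_iterate nt(2))
  moreover have "(X n t - Y n t)\<^sup>2 / 2 ^ n \<le> W n t"
    unfolding W_def using nt(1) by (intro member_le_sum) auto
  ultimately have "(X n t - Y n t)\<^sup>2 / 2 ^ n \<le> 0" by linarith
  then show ?thesis by (simp add: pos_divide_le_eq)
qed

section \<open>Global uniqueness\<close>

text \<open>One integrable function, the sum of the two class K bounds, fixes a step length for all
  of \<open>{0..t}\<close>. Local uniqueness then propagates from time 0 in finitely many
  steps.\<close>

lemma class_K_uniqueness: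
  assumes k: "dyadic_coeffs k"
    and X: "leray_hopf_solution k \<infinity> x X" "class_K k X"
    and Y: "leray_hopf_solution k \<infinity> x Y" "class_K k Y"
    and nt: "n \<ge> 1" "t \<ge> 0"
  shows "X n t = Y n t"
proof -
  obtain C where k0: "k 0 = 0" and C: "\<And>n. n \<ge> 1 \<Longrightarrow> 0 \<le> k n \<and> k n \<le> C * 2 ^ n"
    using k by (auto simp: dyadic_coeffs_def)
  have sol: "dyadic_solution k \<infinity> x X" "dyadic_solution k \<infinity> x Y"
    using X Y by (auto simp: leray_hopf_solution_def)
  obtain b M where b: "b integrable_on {0..t}" "negligible M" "\<And>t. b t \<ge> 0"
    "\<And>n u. n \<ge> 1 \<Longrightarrow> u \<in> {0..t} - M \<Longrightarrow> - k n * X (n + 1) u \<le> b u"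
    using class_K_integrable_bound[OF X(2)] by blast
  obtain c L where c: "c integrable_on {0..t}" "negligible L" "\<And>t. c t \<ge> 0"
    "\<And>n u. n \<ge> 1 \<Longrightarrow> u \<in> {0..t} - L \<Longrightarrow> - k n * Y (n + 1) u \<le> c u"
    using class_K_integrable_bound[OF Y(2)] by blast
  have bc: "(\<lambda>u. b u + c u) integrable_on {0..t}"
    by (intro integrable_add b c)
  obtain d where "d > 0" and d: "\<And>r s. 0 \<le> r \<Longrightarrow> r \<le> s \<Longrightarrow> s \<le> t \<Longrightarrow> s - r < d \<Longrightarrow>
      integral {r..s} (\<lambda>u. b u + c u) < 1 / 2"
    using integral_small_on_short_intervals[OF bc, of "1 / 2"] by auto
  have step: "X n u = Y n u"
    if "0 \<le> r" "r \<le> u" "u \<le> t" "u - r < d" and init: "\<And>n. n \<ge> 1 \<Longrightarrow> X n r = Y n r" and "n \<ge> 1"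
    for r u n
  proof -
    have sub: "{r..u} \<subseteq> {0..}" using that by auto
    have deriv: "(Z n has_real_derivative
        k (n - 1) * (Z (n - 1) t)\<^sup>2 - k n * Z n t * Z (n + 1) t) (at t within {r..u})"
      if "dyadic_solution k \<infinity> x Z" "n \<ge> 1" "t \<in> {r..u}" for Z n t
      using that sub unfolding dyadic_solution_def time_dom_infinity
      by (blast intro: DERIV_subset)
    show ?thesis
    proof (rule local_uniqueness[where X = X and Y = Y and M = "M \<union> L"
          and b = "\<lambda>u. b u + c u" and B = "(norm_H x)\<^sup>2",
          OF k0 C deriv[OF sol(1)] deriv[OF sol(2)] _ _ _ _ init])
      show "(\<lambda>u. b u + c u) integrable_on {r..u}"
        by (rule integrable_on_subinterval[OF bc]) (use that in auto)
      show "- k n * (X (n + 1) v + Y (n + 1) v) \<le> b v + c v"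
        if "n \<ge> 1" "v \<in> {r..u} - (M \<union> L)" for n v
        using b(4)[of n v] c(4)[of n v] that \<open>0 \<le> r\<close> \<open>u \<le> t\<close> by (auto simp: algebra_simps)
      show "(\<Sum>n<N. (X n v)\<^sup>2) \<le> (norm_H x)\<^sup>2" "(\<Sum>n<N. (Y n v)\<^sup>2) \<le> (norm_H x)\<^sup>2"
        if "v \<in> {r..u}" for N v
        using that sub by (auto intro!: leray_hopf_energy_bound X Y)
      show "continuous_on {r..u} (X n)" "continuous_on {r..u} (Y n)" for n
        using sol by (auto intro: continuous_on_subset[OF dyadic_solution_continuous_on sub])
      show "integral {r..u} (\<lambda>u. b u + c u) \<le> 1 / 2"
        using d[of r u] that by simp
    qed (use that b c in auto)
  qed
  \<comment> \<open>Steps of length \<open>d / 2\<close> keep each interval strictly shorter than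
    \<open>d\<close>, as \<open>step\<close> requires.\<close>
  have "\<forall>n\<ge>1. \<forall>u. 0 \<le> u \<longrightarrow> u \<le> t \<longrightarrow> u \<le> real j * (d / 2) \<longrightarrow> X n u = Y n u" for j
  proof (induction j)
    case 0
    then show ?case using sol by (auto simp: dyadic_solution_def)
  next
    case (Suc j)
    show ?case
    proof (intro allI impI)
      fix n u assume u: "n \<ge> (1::nat)" "0 \<le> u" "u \<le> t" "u \<le> real (Suc j) * (d / 2)"
      show "X n u = Y n u"
      proof (rule step)
        \<comment> \<open>The restart point is the last grid point, or \<open>u\<close> itself if
          the earlier steps already reach it; the induction hypothesis covers both cases.\<close>
        show "X n (min u (j * (d / 2))) = Y n (min u (j * (d / 2)))" if "n \<ge> 1" for n
          using Suc that u \<open>d > 0\<close> by auto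
      qed (use u \<open>d > 0\<close> in \<open>auto simp: min_def field_simps\<close>)
    qed
  qed
  moreover obtain j :: nat where "t < real j * (d / 2)"
    using reals_Archimedean3[of "d / 2"] \<open>d > 0\<close> by auto
  ultimately show ?thesis using nt by (metis less_imp_le order_refl)
qed

section \<open>Preservation of signs and membership in class K\<close>

text \<open>
  With the integrating factor \<open>exp (\<integral> k\<^sub>n X\<^sub>n\<^sub>+\<^sub>1)\<close>, the \<open>n\<close>-th equation has a
  nonnegative right-hand side.
\<close>

lemma dyadic_solution_nonneg:
  assumes sol: "dyadic_solution k \<infinity> x X" and k: "k (n - 1) \<ge> 0"
    and n: "n \<ge> 1" "x n \<ge> 0" and t: "t \<ge> 0"
  shows "X n t \<ge> 0"
proof -
  define A where "A u = integral {0..u} (\<lambda>v. k n * X (n + 1) v)" for u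
  have A: "(A has_real_derivative k n * X (n + 1) u) (at u within {0..t})" if "u \<in> {0..t}" for u
    unfolding A_def
    by (intro integral_has_real_derivative continuous_intros that
        continuous_on_subset[OF dyadic_solution_continuous_on[OF sol]]) auto
  have X: "(X n has_real_derivative
      k (n - 1) * (X (n - 1) u)\<^sup>2 - k n * X n u * X (n + 1) u) (at u within {0..t})"
    if "u \<in> {0..t}" for u
    by (rule DERIV_subset[of _ _ _ "{0..}"])
       (use sol n(1) that in \<open>auto simp: dyadic_solution_def time_dom_infinity\<close>)
  have "((\<lambda>u. X n u * exp (A u)) has_real_derivative
      k (n - 1) * (X (n - 1) u)\<^sup>2 * exp (A u)) (at u within {0..t})" if "u \<in> {0..t}" for u
    using that by (auto intro!: derivative_eq_intros A X simp: algebra_simps)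
  then have "((\<lambda>u. k (n - 1) * (X (n - 1) u)\<^sup>2 * exp (A u)) has_integral
      X n t * exp (A t) - X n 0 * exp (A 0)) {0..t}"
    by (intro fundamental_theorem_of_calculus t)
       (auto simp: has_real_derivative_iff_has_vector_derivative)
  then have "0 \<le> X n t * exp (A t) - X n 0 * exp (A 0)"
    by (rule has_integral_nonneg) (use k in auto)
  moreover have "X n 0 = x n" using sol n(1) by (auto simp: dyadic_solution_def)
  ultimately have "0 \<le> X n t * exp (A t)" using n(2) by (simp add: A_def)
  then show ?thesis by (simp add: zero_le_mult_iff)
qed

text \<open>Beyond the last negative initial component all terms of the supremum are nonpositive, so
  finitely many continuous terms control it on a compact set. Measurability holds because it is a
  countable supremum of continuous functions.\<close>

lemma class_K_if_finitely_many_negative: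
  assumes k: "dyadic_coeffs k" and sol: "dyadic_solution k \<infinity> x X"
    and fin: "finite {n. n \<ge> 1 \<and> x n < 0}"
  shows "class_K k X"
  unfolding class_K_def locally_integrable_on_def
proof (intro allI impI)
  fix K :: "real set" assume "compact K \<and> K \<subseteq> {0..}"
  then have K: "compact K" "K \<subseteq> {0..}" by auto
  have cont: "continuous_on K (X n)" for n
    using dyadic_solution_continuous_on[OF sol] K(2) by (rule continuous_on_subset)
  have k_nonneg: "k n \<ge> 0" for n
    using k by (cases "n = 0") (auto simp: dyadic_coeffs_def)
  define f where "f t = (SUP n\<in>{1..}. ereal (- k n * X (n + 1) t))" for t
  obtain N where N: "\<And>n. n \<ge> 1 \<Longrightarrow> x n < 0 \<Longrightarrow> n \<le> N"
    using fin by (auto simp: finite_nat_set_iff_bounded_le)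
  \<comment> \<open>The range up to \<open>Suc N\<close> contains \<open>n = 1\<close> even when
    \<open>N = 0\<close>; that term bounds the supremum from below.\<close>
  define g where "g t = (\<Sum>n\<le>Suc N. \<bar>k n * X (n + 1) t\<bar>)" for t
  have g_ge: "\<bar>k n * X (n + 1) t\<bar> \<le> g t" if "n \<le> Suc N" for n t
    unfolding g_def using that by (intro member_le_sum) auto
  have f_le: "\<bar>f t\<bar> \<le> ereal (g t)" if "t \<in> K" for t
  proof -
    have "- k n * X (n + 1) t \<le> g t" if n: "n \<ge> 1" for n
    proof (cases "n \<le> N")
      case True
      then show ?thesis using g_ge[of n t] by auto
    next
      case False
      \<comment> \<open>The term at \<open>n\<close> involves component \<open>n + 1\<close>, which
        also lies beyond \<open>N\<close>.\<close>
      then have "x (n + 1) \<ge> 0" using N[of "n + 1"] by force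
      then have "X (n + 1) t \<ge> 0"
        using K(2) \<open>t \<in> K\<close> k_nonneg by (intro dyadic_solution_nonneg[OF sol]) auto
      then have "- k n * X (n + 1) t \<le> 0" using k_nonneg by simp
      also have "0 \<le> g t" by (simp add: g_def sum_nonneg)
      finally show ?thesis .
    qed
    then have "f t \<le> ereal (g t)"
      unfolding f_def by (intro SUP_least) auto
    moreover have "ereal (- g t) \<le> f t"
    proof -
      have "ereal (- g t) \<le> ereal (- k 1 * X (1 + 1) t)" using g_ge[of 1 t] by auto
      also have "\<dots> \<le> f t" unfolding f_def by (intro SUP_upper) auto
      finally show ?thesis .
    qed
    ultimately show ?thesis by (cases "f t") auto
  qed
  have K_sets: "K \<in> sets lebesgue" using K(1) by (simp add: compact_imp_closed)
  have "continuous_on K g"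
    unfolding g_def by (intro continuous_intros cont)
  then have "bounded (g ` K)"
    by (intro compact_imp_bounded compact_continuous_image K(1))
  then obtain B where B: "\<And>t. t \<in> K \<Longrightarrow> g t \<le> B"
    unfolding bounded_iff by (metis abs_le_D1 image_eqI real_norm_def)
  have "f \<in> borel_measurable (lebesgue_on K)"
    unfolding f_def
    by (intro borel_measurable_SUP borel_measurable_ereal
        continuous_imp_measurable_on_sets_lebesgue continuous_intros cont K_sets) auto
  moreover have "(\<integral>\<^sup>+ t. e2ennreal \<bar>f t\<bar> \<partial>lebesgue_on K) < \<infinity>"
  proof -
    have "(\<integral>\<^sup>+ t. e2ennreal \<bar>f t\<bar> \<partial>lebesgue_on K) \<le> (\<integral>\<^sup>+ t. ennreal B \<partial>lebesgue_on K)"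
    proof (intro nn_integral_mono)
      fix t assume "t \<in> space (lebesgue_on K)"
      then have "t \<in> K" by simp
      with f_le[of t] B[of t] have "\<bar>f t\<bar> \<le> ereal B"
        by (meson ereal_less_eq(3) order.trans)
      then show "e2ennreal \<bar>f t\<bar> \<le> ennreal B"
        unfolding ennreal.abs_eq[symmetric] by (metis e2ennreal_mono e2ennreal_ereal)
    qed
    also have "\<dots> = ennreal B * emeasure lebesgue K"
      using K_sets by (simp add: emeasure_restrict_space)
    also have "\<dots> < \<infinity>"
      using fmeasurableD2[OF lmeasurable_compact[OF K(1)]]
      by (simp add: ennreal_mult_less_top less_top del: emeasure_completion)
    finally show ?thesis .
  qed
  ultimately show "(\<lambda>t. SUP n\<in>{1..}. ereal (- k n * X (n + 1) t)) \<in> borel_measurable (lebesgue_on K) \<and>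
      (\<integral>\<^sup>+ t. e2ennreal \<bar>SUP n\<in>{1..}. ereal (- k n * X (n + 1) t)\<bar> \<partial>lebesgue_on K) < \<infinity>"
    unfolding f_def by blast
qed

theorem theorem1p6:
  fixes k x :: "nat \<Rightarrow> real" and X1 X2 :: "nat \<Rightarrow> real \<Rightarrow> real"
  assumes "dyadic_coeffs k"
    and "in_H x"
    and "leray_hopf_solution k \<infinity> x X1"
    and "leray_hopf_solution k \<infinity> x X2"
  shows "(class_K k X1 \<and> class_K k X2 \<longrightarrow> (\<forall>n\<ge>1. \<forall>t\<ge>0. X1 n t = X2 n t)) \<and>
         (finite {n. n \<ge> 1 \<and> x n < 0} \<longrightarrow> class_K k X1 \<and> class_K k X2)"
  using assms(1,3,4) class_K_uniqueness class_K_if_finitely_many_negative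
  unfolding leray_hopf_solution_def by blast

end
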